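(* Let $V$ be a Hilbert space and a vector lattice with $V_+$ closed, and let $\Phi\colon V\to V$ be increasing. Suppose that (a) either there exists $v_0\in V$ such that $v_0\le\Phi(v)$ for all $v\in V$, or there is a constant $C_X<C_a/C_b$ with $\|\Phi(v)\|_V\le C_X\|v\|_V$ for all $v\in V$; and (b) if $\{v_n\}\subset V$ is decreasing with $v_n\rightharpoonup v$ in $V$ and $v\le\Phi(v_n)$ for all $n$, then $v\le\Phi(v)$. Then for any $f\in V^*$ there exists $y\in V$ with $y\le A^{-1}f$ solving $$y\le\Phi(y),\qquad \langle Ay-f,\,y-v\rangle\le 0\quad\forall v\in V:\ v\le\Phi(y),$$ and $y$ is the weak limit in $V$ of the sequence defined by $y_0:=A^{-1}f$, $y_n:=S(f,y_{n-1})$ for $n\ge 1$.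
   Context: $V$ is a real space with dual $V^*$ and duality pairing $\langle\cdot,\cdot\rangle$. $V$ is a vector lattice for a partial order $\le$: $u\le v$ implies $u+w\le v+w$ and $\lambda u\le\lambda v$ for all $w\in V$, $\lambda\ge0$, and any $u,v\in V$ have $\inf(u,v),\sup(u,v)\in V$. $V_+:=\{v\in V:v\ge0\}$. $\Phi$ increasing means $u\le v\Rightarrow\Phi(u)\le\Phi(v)$. A sequence is decreasing if $v_{n+1}\le v_n$ for all $n$. With $u^+:=\sup(0,u)$, $u^-:=u^+-u$, the operator $A\colon V\to V^*$ is linear and there are constants $C_a,C_b>0$ with $\langle Au,v\rangle\le C_b\|u\|_V\|v\|_V$, $\langle Au,u\rangle\ge C_a\|u\|_V^2$ and $\langle Au^+,u^-\rangle\le0$ for all $u,v\in V$. For $f\in V^*$ and $\psi\in V$, $S(f,\psi)$ denotes the unique solution $z\in V$ of the variational inequality $z\le\Phi(\psi)$, $\langle Az-f,z-v\rangle\le0$ for all $v\in V$ with $v\le\Phi(\psi)$. *)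

theory Defs
  imports "HOL-Analysis.Analysis"
begin

definition converges_weakly :: "(nat \<Rightarrow> 'a::real_normed_vector) \<Rightarrow> 'a \<Rightarrow> bool" where
  "converges_weakly v l \<longleftrightarrow>
     (\<forall>g :: 'a \<Rightarrow>\<^sub>L real. (\<lambda>n. blinfun_apply g (v n)) \<longlonglongrightarrow> blinfun_apply g l)"

definition pos_part :: "'a::{ab_group_add, lattice} \<Rightarrow> 'a" where
  "pos_part u = sup 0 u"

definition neg_part :: "'a::{ab_group_add, lattice} \<Rightarrow> 'a" where
  "neg_part u = pos_part u - u"

definition solves_vi ::
  "('a::{real_normed_vector, ord} \<Rightarrow> 'a \<Rightarrow>\<^sub>L real) \<Rightarrow> ('a \<Rightarrow>\<^sub>L real) \<Rightarrow> 'a \<Rightarrow> 'a \<Rightarrow> bool" where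
  "solves_vi A f w z \<longleftrightarrow>
     z \<le> w \<and> (\<forall>v. v \<le> w \<longrightarrow> blinfun_apply (A z - f) (z - v) \<le> 0)"

text \<open>The definite description below is meaningful because, for coercive bounded linear
  \<open>A\<close> on a Hilbert space with closed positive cone, the variational inequality with a
  given obstacle has exactly one solution.\<close>

definition vi_sol ::
  "('a::{real_normed_vector, ord} \<Rightarrow> 'a \<Rightarrow>\<^sub>L real) \<Rightarrow> ('a \<Rightarrow> 'a) \<Rightarrow> ('a \<Rightarrow>\<^sub>L real) \<Rightarrow> 'a \<Rightarrow> 'a" where
  "vi_sol A \<Phi> f \<psi> = (THE z. solves_vi A f (\<Phi> \<psi>) z)"

text \<open>Likewise \<open>inv A f\<close> is the unique preimage of \<open>f\<close>: such an \<open>A\<close> is bijective by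
  Lax--Milgram.\<close>

primrec qvi_iter ::
  "('a::{real_normed_vector, ord} \<Rightarrow> 'a \<Rightarrow>\<^sub>L real) \<Rightarrow> ('a \<Rightarrow> 'a) \<Rightarrow> ('a \<Rightarrow>\<^sub>L real) \<Rightarrow> nat \<Rightarrow> 'a" where
  "qvi_iter A \<Phi> f 0 = inv A f"
| "qvi_iter A \<Phi> f (Suc n) = vi_sol A \<Phi> f (qvi_iter A \<Phi> f n)"

end

theory Submission
  imports Defs
begin

text \<open>By T-monotonicity the obstacle problem depends monotonically on the obstacle, so the
  iterates decrease; testing with \<open>v0\<close> or with \<open>\<Phi> (y n)\<close> bounds them. A bounded
  decreasing sequence in a Hilbert space with closed cone converges weakly, to a lower bound
  \<open>y\<close> of the sequence. Since \<open>y \<le> y (n + 1) \<le> \<Phi> (y n)\<close>, hypothesis (b) makes \<open>y\<close>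
  feasible. Any \<open>v \<le> \<Phi> y\<close> is an admissible test function for every iterate, and weak lower
  semicontinuity of \<open>u \<mapsto> \<langle>A u, u\<rangle>\<close> gives the inequality in the limit.\<close>

section \<open>Minimisation over closed convex sets\<close>

text \<open>This is the first-order condition at the minimiser over \<open>K\<close> of the
  quadratic \<open>J\<close>. With \<open>K = UNIV\<close> it yields Riesz representation; with
  \<open>g\<close> the inner product with \<open>x\<close> it yields the projection of
  \<open>x\<close> onto \<open>K\<close>.\<close>

lemma convex_minimizer:
  fixes K :: "'a::{real_inner, complete_space} set" and g :: "'a \<Rightarrow>\<^sub>L real"
  assumes "closed K" "convex K" "K \<noteq> {}"
  shows "\<exists>z\<in>K. \<forall>v\<in>K. blinfun_apply g (v - z) \<le> z \<bullet> (v - z)"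
proof -
  define J where "J v = (norm v)\<^sup>2 / 2 - blinfun_apply g v" for v
  have J_ge: "J v \<ge> - (norm g)\<^sup>2 / 2" for v
  proof -
    have "blinfun_apply g v \<le> norm g * norm v"
      using norm_blinfun[of g v] by simp
    moreover have "(norm v - norm g)\<^sup>2 \<ge> 0"
      by simp
    ultimately show ?thesis
      unfolding J_def power2_diff by (simp add: field_simps)
  qed
  define d where "d = (INF v\<in>K. J v)"
  have d_le: "d \<le> J v" if "v \<in> K" for v
    unfolding d_def using J_ge that by (intro cINF_lower bdd_belowI2) auto
  have "\<exists>v\<in>K. J v < d + inverse (real (Suc n))" for n
  proof (rule ccontr)
    assume "\<not> ?thesis"
    then have "d + inverse (real (Suc n)) \<le> d"
      unfolding d_def using \<open>K \<noteq> {}\<close> by (intro cINF_greatest) (auto simp: not_less)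
    then show False by simp
  qed
  then obtain x where xK: "x n \<in> K" and Jx: "J (x n) < d + inverse (real (Suc n))" for n
    by metis
  \<comment> \<open>Parallelogram law: the left side is \<open>4 * (J a + J b)\<close> minus 8 times
    \<open>J\<close> at the midpoint, which lies in \<open>K\<close>. Hence minimising sequences are
    Cauchy.\<close>
  have gap: "(norm (a - b))\<^sup>2 \<le> 4 * (J a + J b - 2 * d)" if "a \<in> K" "b \<in> K" for a b
  proof -
    have "(1/2) *\<^sub>R a + (1/2) *\<^sub>R b \<in> K"
      using convexD[OF \<open>convex K\<close> that, of "1/2" "1/2"] by simp
    from d_le[OF this] show ?thesis
      unfolding J_def power2_norm_eq_inner
      by (simp add: inner_simps inner_commute blinfun.add_right blinfun.scaleR_right algebra_simps)
  qed
  have "Cauchy x"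
  proof (rule metric_CauchyI)
    fix e :: real assume "e > 0"
    then obtain M where M: "inverse (real (Suc M)) < e\<^sup>2 / 8"
      using reals_Archimedean[of "e\<^sup>2 / 8"] by auto
    have small: "J (x n) < d + e\<^sup>2 / 8" if "n \<ge> M" for n
    proof -
      have "inverse (real (Suc n)) \<le> inverse (real (Suc M))"
        using that by (simp add: field_simps)
      with Jx[of n] M show ?thesis by linarith
    qed
    have "dist (x m) (x n) < e" if "m \<ge> M" "n \<ge> M" for m n
    proof -
      have "(norm (x m - x n))\<^sup>2 < e\<^sup>2"
        using gap[OF xK xK, of m n] small[OF that(1)] small[OF that(2)] by (simp add: field_simps)
      then show ?thesis
        using \<open>e > 0\<close> by (simp add: dist_norm power2_less_imp_less)
    qed
    then show "\<exists>M. \<forall>m\<ge>M. \<forall>n\<ge>M. dist (x m) (x n) < e" by blast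
  qed
  then obtain z where z: "x \<longlonglongrightarrow> z"
    using Cauchy_convergent convergent_def by blast
  have zK: "z \<in> K"
    using closed_sequentially[OF \<open>closed K\<close> _ z] xK by blast
  have "(\<lambda>n. J (x n)) \<longlonglongrightarrow> J z"
    unfolding J_def by (intro tendsto_intros z) auto
  moreover have "(\<lambda>n. d + inverse (real (Suc n))) \<longlonglongrightarrow> d + 0"
    by (intro tendsto_intros LIMSEQ_inverse_real_of_nat)
  ultimately have "J z \<le> d + 0"
    using Jx by (intro LIMSEQ_le) (auto intro: less_imp_le)
  then have zmin: "J z \<le> J v" if "v \<in> K" for v
    using d_le[OF that] by simp
  have "blinfun_apply g (v - z) \<le> z \<bullet> (v - z)" if vK: "v \<in> K" for v
  proof (rule ccontr)
    define c where "c = z \<bullet> (v - z) - blinfun_apply g (v - z)"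
    define q where "q = (norm (v - z))\<^sup>2"
    assume "\<not> ?thesis"
    then have c: "c < 0" by (simp add: c_def)
    have q: "q \<ge> 0" by (simp add: q_def)
    \<comment> \<open>\<open>c\<close> is the slope of \<open>J\<close> at \<open>z\<close> towards
      \<open>v\<close>. If \<open>c < 0\<close>, this \<open>t\<close> is small enough that
      \<open>t * q / 2\<close> cannot compensate it, against minimality; \<open>q + 1\<close> avoids
      a zero denominator.\<close>
    define t where "t = min 1 (- c / (q + 1))"
    have t: "0 < t" "t \<le> 1"
      using c q by (auto simp: t_def divide_neg_pos)
    have "t \<le> - c / (q + 1)"
      by (simp add: t_def)
    then have tq: "t * (q + 1) \<le> - c"
      using q pos_le_divide_eq[of "q + 1" t "- c"] by simp
    have "z + t *\<^sub>R (v - z) = (1 - t) *\<^sub>R z + t *\<^sub>R v"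
      by (simp add: algebra_simps)
    also have "\<dots> \<in> K"
      using convexD[OF \<open>convex K\<close> zK vK, of "1 - t" t] t by simp
    finally have "J z \<le> J (z + t *\<^sub>R (v - z))"
      by (rule zmin)
    also have "\<dots> = J z + t * (c + t * q / 2)"
      unfolding J_def c_def q_def power2_norm_eq_inner
      by (simp add: inner_simps inner_commute blinfun.add_right blinfun.diff_right
          blinfun.scaleR_right field_simps)
    finally have "0 \<le> c + t * q / 2"
      using t(1) by (simp add: zero_le_mult_iff)
    with t(1) tq c show False
      by (simp add: algebra_simps)
  qed
  with zK show ?thesis by blast
qed

text \<open>When minimising over the whole space, both \<open>v\<close> and \<open>- v\<close> are
  admissible directions, so the optimality inequality becomes an equation.\<close>

lemma riesz_representation:
  fixes g :: "'a::{real_inner, complete_space} \<Rightarrow>\<^sub>L real"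
  obtains r where "\<And>v. blinfun_apply g v = r \<bullet> v"
proof -
  obtain z where z: "blinfun_apply g (v - z) \<le> z \<bullet> (v - z)" for v
    using convex_minimizer[of UNIV g] by auto
  have le: "blinfun_apply g v \<le> z \<bullet> v" for v
    using z[of "v + z"] by simp
  have "blinfun_apply g v = z \<bullet> v" for v
    using le[of v] le[of "- v"] by (simp add: blinfun.minus_right)
  then show thesis by (rule that)
qed

section \<open>Variational inequalities for coercive operators\<close>

locale coercive_operator =
  fixes A :: "'a::{real_inner, complete_space} \<Rightarrow> 'a \<Rightarrow>\<^sub>L real"
    and C\<^sub>a C\<^sub>b :: real
  assumes linear: "linear A"
    and C_pos: "C\<^sub>a > 0" "C\<^sub>b > 0"
    and bounded: "\<And>u v. blinfun_apply (A u) v \<le> C\<^sub>b * norm u * norm v"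
    and coercive: "\<And>u. blinfun_apply (A u) u \<ge> C\<^sub>a * (norm u)\<^sup>2"
begin

lemma abs_bounded: "\<bar>blinfun_apply (A u) v\<bar> \<le> C\<^sub>b * norm u * norm v"
  using bounded[of u v] bounded[of u "- v"] by (simp add: blinfun.minus_right)

lemmas A_simps = linear_add[OF linear] linear_diff[OF linear] linear_cmul[OF linear]
  linear_neg[OF linear]
  blinfun.add_left blinfun.add_right blinfun.diff_left blinfun.diff_right
  blinfun.scaleR_left blinfun.scaleR_right blinfun.minus_left blinfun.minus_right

lemma eq_zero_if_nonpos:
  assumes "blinfun_apply (A u) u \<le> 0"
  shows "u = 0"
proof -
  have "C\<^sub>a * (norm u)\<^sup>2 \<le> 0"
    using coercive[of u] assms by linarith
  then show ?thesis
    using C_pos by (simp add: mult_le_0_iff)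
qed

text \<open>Lions--Stampacchia: for \<open>\<rho> = C\<^sub>a / C\<^sub>b\<^sup>2\<close> the map sending \<open>u\<close> to the projection onto \<open>K\<close>
  of \<open>u - \<rho> (A u - f)\<close> is a contraction.\<close>

lemma variational_inequality_ex:
  assumes K: "closed K" "convex K" "K \<noteq> {}"
  shows "\<exists>z\<in>K. \<forall>v\<in>K. blinfun_apply (A z - f) (z - v) \<le> 0"
proof -
  \<comment> \<open>Minimises \<open>1 - 2 * \<rho> * C\<^sub>a + \<rho>\<^sup>2 *
    C\<^sub>b\<^sup>2\<close>, the bound for the squared Lipschitz factor; the minimum is
    \<open>1 - C\<^sub>a\<^sup>2 / C\<^sub>b\<^sup>2\<close>.\<close>
  define \<rho> where "\<rho> = C\<^sub>a / C\<^sub>b\<^sup>2"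
  have \<rho>: "\<rho> > 0" using C_pos by (simp add: \<rho>_def)
  \<comment> \<open>\<open>G u\<close> is the functional represented by
    \<open>u - \<rho> (A u - f)\<close>, so the minimiser belonging to it is the projection of that
    point.\<close>
  define G where "G u = blinfun_inner_right u - \<rho> *\<^sub>R (A u - f)" for u
  have G: "blinfun_apply (G u) v = u \<bullet> v - \<rho> * blinfun_apply (A u - f) v" for u v
    by (simp add: G_def blinfun.diff_left blinfun.scaleR_left)
  obtain T where TK: "T u \<in> K"
    and T: "v \<in> K \<Longrightarrow> blinfun_apply (G u) (v - T u) \<le> T u \<bullet> (v - T u)" for u v
    using convex_minimizer[OF K, of "G _"] by metis
  \<comment> \<open>The \<open>max 0\<close> covers \<open>C\<^sub>a > C\<^sub>b\<close>, which can
    happen only in the trivial space.\<close>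
  define c where "c = sqrt (max 0 (1 - C\<^sub>a\<^sup>2 / C\<^sub>b\<^sup>2))"
  have c: "0 \<le> c" "c < 1"
    using C_pos by (auto simp: c_def max_def)
  have contraction: "dist (T u1) (T u2) \<le> c * dist u1 u2" for u1 u2
  proof -
    define u where "u = u1 - u2"
    define z where "z = T u1 - T u2"
    obtain r where r: "blinfun_apply (A u) v = r \<bullet> v" for v
      using riesz_representation by metis
    have "norm r * norm r \<le> C\<^sub>b * norm u * norm r"
      using bounded[of u r] by (simp add: r flip: power2_norm_eq_inner power2_eq_square)
    then have "norm r \<le> C\<^sub>b * norm u"
      using C_pos by (cases "r = 0") auto
    then have r2: "r \<bullet> r \<le> C\<^sub>b\<^sup>2 * (u \<bullet> u)"
      using power_mono[of "norm r" "C\<^sub>b * norm u" 2]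
      by (simp add: power_mult_distrib power2_norm_eq_inner)
    have ru: "r \<bullet> u \<ge> C\<^sub>a * (u \<bullet> u)"
      using coercive[of u] by (simp add: r power2_norm_eq_inner)
    have "(norm (u - \<rho> *\<^sub>R r))\<^sup>2 = u \<bullet> u - 2 * \<rho> * (r \<bullet> u) + \<rho>\<^sup>2 * (r \<bullet> r)"
      unfolding power2_norm_eq_inner
      by (simp add: inner_simps inner_commute power2_eq_square algebra_simps)
    also have "\<dots> \<le> u \<bullet> u - 2 * \<rho> * (C\<^sub>a * (u \<bullet> u)) + \<rho>\<^sup>2 * (C\<^sub>b\<^sup>2 * (u \<bullet> u))"
      using r2 ru \<rho> by (intro add_mono diff_mono mult_left_mono) auto
    also have "\<dots> = (1 - C\<^sub>a\<^sup>2 / C\<^sub>b\<^sup>2) * (u \<bullet> u)"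
      using C_pos by (simp add: \<rho>_def field_simps power2_eq_square)
    also have "\<dots> \<le> max 0 (1 - C\<^sub>a\<^sup>2 / C\<^sub>b\<^sup>2) * (u \<bullet> u)"
      by (intro mult_right_mono) auto
    also have "\<dots> = (c * norm u)\<^sup>2"
      by (simp add: c_def power_mult_distrib power2_norm_eq_inner)
    finally have le: "norm (u - \<rho> *\<^sub>R r) \<le> c * norm u"
      by (rule power2_le_imp_le) (simp add: c)
    \<comment> \<open>Projections do not increase distances: each projection inequality is tested
      with the other projected point, and the two are added.\<close>
    have "blinfun_apply (G u1) (T u2 - T u1) + blinfun_apply (G u2) (T u1 - T u2)
        \<le> T u1 \<bullet> (T u2 - T u1) + T u2 \<bullet> (T u1 - T u2)"
      by (intro add_mono T TK)
    then have "z \<bullet> z \<le> u \<bullet> z - \<rho> * blinfun_apply (A u) z"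
      by (simp add: G z_def u_def A_simps inner_simps algebra_simps)
    also have "\<dots> = (u - \<rho> *\<^sub>R r) \<bullet> z"
      by (simp add: r inner_simps)
    also have "\<dots> \<le> norm (u - \<rho> *\<^sub>R r) * norm z"
      by (rule norm_cauchy_schwarz)
    finally have "norm z * norm z \<le> norm (u - \<rho> *\<^sub>R r) * norm z"
      by (simp flip: power2_norm_eq_inner power2_eq_square)
    then have "norm z \<le> norm (u - \<rho> *\<^sub>R r)"
      by (cases "z = 0") auto
    with le show ?thesis
      by (simp add: dist_norm z_def u_def)
  qed
  have "\<exists>!z. T z = z"
    using c contraction by (intro banach_fix_type) auto
  then obtain z where Tz: "T z = z" by blast
  \<comment> \<open>At a fixed point the inner products with \<open>z\<close> cancel from the
    projection inequality.\<close>
  have "blinfun_apply (A z - f) (z - v) \<le> 0" if "v \<in> K" for v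
  proof -
    have "\<rho> * blinfun_apply (A z - f) (z - v) \<le> 0"
      using T[OF that, of z] by (simp add: Tz G A_simps algebra_simps)
    then show ?thesis
      using \<rho> by (simp add: mult_le_0_iff)
  qed
  then show ?thesis
    using TK[of z] Tz by auto
qed

text \<open>Lax-Milgram: coercivity gives injectivity, and a variational inequality over the whole
  space is an equation. Thus \<open>inv A f\<close> is a genuine preimage.\<close>

lemma bij_A: "bij A"
proof (rule bijI)
  show "inj A"
  proof (rule injI)
    fix x y assume "A x = A y"
    then have "blinfun_apply (A (x - y)) (x - y) \<le> 0"
      by (simp add: A_simps)
    from eq_zero_if_nonpos[OF this] show "x = y" by simp
  qed
  show "surj A"
    unfolding surj_def
  proof
    fix f
    obtain z where z: "blinfun_apply (A z - f) (z - v) \<le> 0" for v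
      using variational_inequality_ex[of UNIV f] by auto
    have "blinfun_apply (A z - f) v \<le> 0" for v
      using z[of "z - v"] by simp
    from this[of "- _"] this have "A z - f = 0"
      by (intro blinfun_eqI) (auto simp: blinfun.minus_right intro: antisym)
    then show "\<exists>x. f = A x" by auto
  qed
qed

text \<open>Weak convergence is tested by functionals of the moving vector; this makes it applicable
  to the first argument of the bilinear form.\<close>

lemma blinfun_of_fixed_test:
  obtains h :: "'a \<Rightarrow>\<^sub>L real" where "\<And>u. blinfun_apply h u = blinfun_apply (A u) v"
proof -
  have "bounded_linear (\<lambda>u. blinfun_apply (A u) v)"
    using abs_bounded by (intro bounded_linear_intro[where K = "C\<^sub>b * norm v"])
      (auto simp: A_simps mult_ac)
  from bounded_linear_Blinfun_apply[OF this] show thesis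
    by (intro that[of "Blinfun (\<lambda>u. blinfun_apply (A u) v)"]) simp
qed

text \<open>Coercivity makes the left side quadratic in \<open>norm z\<close>, so control of one
  test vector \<open>v\<close> controls \<open>z\<close>.\<close>

lemma estimate_if_nonpos:
  assumes "blinfun_apply (A z - f) (z - v) \<le> 0"
  shows "C\<^sub>a * (norm z)\<^sup>2 \<le> C\<^sub>b * norm z * norm v + norm f * (norm z + norm v)"
proof -
  have "C\<^sub>a * (norm z)\<^sup>2 \<le> blinfun_apply (A z) z"
    by (rule coercive)
  also have "\<dots> \<le> blinfun_apply (A z) v + blinfun_apply f (z - v)"
    using assms by (simp add: A_simps)
  also have "\<dots> \<le> C\<^sub>b * norm z * norm v + norm f * norm (z - v)"
    using bounded[of z v] norm_blinfun[of f "z - v"] by simp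
  also have "\<dots> \<le> C\<^sub>b * norm z * norm v + norm f * (norm z + norm v)"
    by (intro add_left_mono mult_left_mono norm_triangle_ineq4) auto
  finally show ?thesis .
qed

lemma weak_limit_inequality:
  assumes weak: "converges_weakly y l"
    and ineq: "\<And>n. blinfun_apply (A (y (Suc n)) - f) (y (Suc n) - v) \<le> 0"
  shows "blinfun_apply (A l - f) (l - v) \<le> 0"
proof -
  have lim: "(\<lambda>n. blinfun_apply g (y (Suc n))) \<longlonglongrightarrow> blinfun_apply g l" for g :: "'a \<Rightarrow>\<^sub>L real"
    using weak unfolding converges_weakly_def by (intro LIMSEQ_Suc) blast
  have lim_A: "(\<lambda>n. blinfun_apply (A (y (Suc n))) w) \<longlonglongrightarrow> blinfun_apply (A l) w" for w
  proof -
    obtain h :: "'a \<Rightarrow>\<^sub>L real" where "blinfun_apply h u = blinfun_apply (A u) w" for u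
      using blinfun_of_fixed_test by blast
    then show ?thesis
      using lim[of h] by simp
  qed
  \<comment> \<open>Positivity of the form at \<open>y (Suc n) - l\<close> bounds the quadratic term
    from below by terms affine in \<open>y (Suc n)\<close>. After this replacement every term passes
    to the weak limit.\<close>
  have "(\<lambda>n. blinfun_apply (A (y (Suc n))) (l - v) + blinfun_apply (A l) (y (Suc n))
        - blinfun_apply (A l) l - blinfun_apply f (y (Suc n)) + blinfun_apply f v)
      \<longlonglongrightarrow> blinfun_apply (A l) (l - v) + blinfun_apply (A l) l
        - blinfun_apply (A l) l - blinfun_apply f l + blinfun_apply f v"
    by (intro tendsto_intros lim lim_A)
  moreover have "blinfun_apply (A (y (Suc n))) (l - v) + blinfun_apply (A l) (y (Suc n))
      - blinfun_apply (A l) l - blinfun_apply f (y (Suc n)) + blinfun_apply f v \<le> 0" for n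
  proof -
    have "0 \<le> C\<^sub>a * (norm (y (Suc n) - l))\<^sup>2"
      using C_pos by simp
    also have "\<dots> \<le> blinfun_apply (A (y (Suc n) - l)) (y (Suc n) - l)"
      by (rule coercive)
    finally show ?thesis
      using ineq[of n] by (simp add: A_simps)
  qed
  ultimately have "blinfun_apply (A l) (l - v) + blinfun_apply (A l) l
        - blinfun_apply (A l) l - blinfun_apply f l + blinfun_apply f v \<le> 0"
    by (intro LIMSEQ_le_const2) auto
  then show ?thesis
    by (simp add: A_simps)
qed

end

section \<open>Monotone sequences in a Hilbert space with closed cone\<close>

text \<open>For the projection \<open>p\<close> of \<open>x\<close> onto the cone,
  \<open>p - x\<close> lies in the dual cone and \<open>(p - x) \<bullet> p \<le> 0\<close>.
  Applying the hypothesis to \<open>p - x\<close> then forces \<open>p = x\<close>.\<close>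

lemma bipolar_cone:
  fixes x :: "'a::{real_inner, complete_space, ordered_real_vector}"
  assumes cone: "closed {v::'a. 0 \<le> v}"
    and dual: "\<And>d. (\<And>v. 0 \<le> v \<Longrightarrow> 0 \<le> d \<bullet> v) \<Longrightarrow> 0 \<le> d \<bullet> x"
  shows "0 \<le> x"
proof -
  have "convex {v::'a. 0 \<le> v}"
    by (intro convexI) (auto intro: add_nonneg_nonneg scaleR_nonneg_nonneg)
  then obtain p where p: "0 \<le> p" and proj: "0 \<le> v \<Longrightarrow> x \<bullet> (v - p) \<le> p \<bullet> (v - p)" for v
    using convex_minimizer[OF cone, of "blinfun_inner_right x"] by force
  have "0 \<le> (p - x) \<bullet> v" if "0 \<le> v" for v
    using proj[of "v + p"] that p by (simp add: inner_simps add_nonneg_nonneg)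
  then have "0 \<le> (p - x) \<bullet> x"
    by (rule dual)
  moreover have "(p - x) \<bullet> p \<le> 0"
    using proj[of 0] by (simp add: inner_simps)
  ultimately have "(p - x) \<bullet> (p - x) \<le> 0"
    by (simp add: inner_simps inner_commute)
  then have "p = x"
    using inner_ge_zero[of "p - x"] by (metis antisym inner_eq_zero_iff right_minus_eq)
  with p show ?thesis by simp
qed

text \<open>The residual of the projection of \<open>u\<close> onto \<open>L\<close> is orthogonal
  to \<open>L\<close>, hence zero.\<close>

lemma closed_subspace_eq_UNIV:
  fixes L :: "'a::{real_inner, complete_space} set"
  assumes "closed L" "subspace L" and perp: "\<And>x. (\<And>h. h \<in> L \<Longrightarrow> x \<bullet> h = 0) \<Longrightarrow> x = 0"
  shows "L = UNIV"
proof -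
  have "u \<in> L" for u
  proof -
    obtain p where p: "p \<in> L" and proj: "v \<in> L \<Longrightarrow> u \<bullet> (v - p) \<le> p \<bullet> (v - p)" for v
      using convex_minimizer[OF \<open>closed L\<close> subspace_imp_convex[OF \<open>subspace L\<close>],
          of "blinfun_inner_right u"] subspace_0[OF \<open>subspace L\<close>] by auto
    have le: "(u - p) \<bullet> h \<le> 0" if "h \<in> L" for h
      using proj[of "h + p"] subspace_add[OF \<open>subspace L\<close> that p] by (simp add: inner_simps)
    have "(u - p) \<bullet> h = 0" if "h \<in> L" for h
      using le[OF that] le[OF subspace_neg[OF \<open>subspace L\<close> that]] by simp
    from perp[OF this] p show ?thesis by simp
  qed
  then show ?thesis by blast
qed

text \<open>The vectors \<open>h\<close> for which \<open>h \<bullet> y n\<close> converges form a closed subspace containing the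
  dual cone, and by the bipolar theorem only \<open>0\<close> is orthogonal to the dual cone.\<close>

lemma bounded_decseq_converges_weakly:
  fixes y :: "nat \<Rightarrow> 'a::{real_inner, complete_space, ordered_real_vector}"
  assumes cone: "closed {v::'a. 0 \<le> v}"
    and dec: "decseq y" and bnd: "\<And>n. norm (y n) \<le> B"
  shows "\<exists>l. converges_weakly y l"
proof -
  define L where "L = {h. convergent (\<lambda>n. h \<bullet> y n)}"
  have B: "B \<ge> 0" using order_trans[OF norm_ge_zero bnd] .
  have inner_le: "\<bar>h \<bullet> y n\<bar> \<le> norm h * B" for h n
    using Cauchy_Schwarz_ineq2[of h "y n"] mult_left_mono[OF bnd[of n] norm_ge_zero[of h]]
    by linarith
  have "subspace L"
    unfolding L_def subspace_def
    by (auto simp: inner_simps intro: convergent_add convergent_mult convergent_const)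
  moreover have "closed L"
    unfolding closed_sequential_limits
  proof (intro allI impI, elim conjE)
    fix hs h assume hs: "\<forall>k. hs k \<in> L" and h: "hs \<longlonglongrightarrow> h"
    have "Cauchy (\<lambda>n. h \<bullet> y n)"
    proof (rule metric_CauchyI)
      fix e :: real assume "e > 0"
      \<comment> \<open>Three-epsilon argument: \<open>hs k\<close> replaces \<open>h\<close>
        uniformly in \<open>n\<close> because \<open>y\<close> is bounded; \<open>B + 1\<close>
        allows for \<open>B = 0\<close>.\<close>
      then have "e / (3 * (B + 1)) > 0" using B by simp
      with h obtain k where "norm (hs k - h) < e / (3 * (B + 1))"
        unfolding LIMSEQ_iff by blast
      then have "norm (hs k - h) * (B + 1) < e / 3"
        using B by (simp add: field_simps)
      then have "norm (hs k - h) * B < e / 3"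
        using norm_ge_zero[of "hs k - h"] unfolding distrib_left by linarith
      then have close: "\<bar>(hs k - h) \<bullet> y n\<bar> < e / 3" for n
        using inner_le[of "hs k - h" n] by linarith
      have "Cauchy (\<lambda>n. hs k \<bullet> y n)"
        using hs by (auto simp: L_def intro: convergent_Cauchy)
      then obtain M where M: "\<bar>hs k \<bullet> y m - hs k \<bullet> y n\<bar> < e / 3" if "m \<ge> M" "n \<ge> M" for m n
        using metric_CauchyD[of _ "e / 3"] \<open>e > 0\<close>
        by (metis dist_real_def divide_pos_pos zero_less_numeral)
      have "dist (h \<bullet> y m) (h \<bullet> y n) < e" if "m \<ge> M" "n \<ge> M" for m n
        using M[OF that] close[of m] close[of n]
        unfolding dist_real_def inner_diff_left by linarith
      then show "\<exists>M. \<forall>m\<ge>M. \<forall>n\<ge>M. dist (h \<bullet> y m) (h \<bullet> y n) < e" by blast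
    qed
    then show "h \<in> L"
      by (simp add: L_def Cauchy_convergent_iff)
  qed
  moreover have "x = 0" if x: "\<And>h. h \<in> L \<Longrightarrow> x \<bullet> h = 0" for x
  proof -
    \<comment> \<open>Against a dual-cone vector the decreasing sequence becomes a bounded
      decreasing real sequence, so \<open>d\<close> belongs to \<open>L\<close>.\<close>
    have dual: "d \<bullet> x = 0" if d: "\<And>v. 0 \<le> v \<Longrightarrow> 0 \<le> d \<bullet> v" for d
    proof -
      have "decseq (\<lambda>n. d \<bullet> y n)"
      proof (rule decseq_SucI)
        fix n
        show "d \<bullet> y (Suc n) \<le> d \<bullet> y n"
          using d[of "y n - y (Suc n)"] decseq_SucD[OF dec] by (simp add: inner_simps)
      qed
      then have "convergent (\<lambda>n. d \<bullet> y n)"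
        using inner_le[of d] by (intro Bseq_monoseq_convergent BseqI') (auto simp: monoseq_iff)
      then show ?thesis
        using x[of d] by (simp add: L_def inner_commute)
    qed
    have "0 \<le> x" "0 \<le> - x"
      by (rule bipolar_cone[OF cone], use dual in force)+
    then show "x = 0" by simp
  qed
  ultimately have "L = UNIV"
    by (intro closed_subspace_eq_UNIV) auto
  then have conv: "(\<lambda>n. h \<bullet> y n) \<longlonglongrightarrow> lim (\<lambda>n. h \<bullet> y n)" for h
    by (auto simp: L_def convergent_LIMSEQ_iff)
  \<comment> \<open>The limit functional is bounded by \<open>B\<close>; its Riesz representative is
    the weak limit.\<close>
  have "bounded_linear (\<lambda>h. lim (\<lambda>n. h \<bullet> y n))"
  proof (rule bounded_linear_intro[where K = B])
    fix h k :: 'a and c :: real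
    show "lim (\<lambda>n. (h + k) \<bullet> y n) = lim (\<lambda>n. h \<bullet> y n) + lim (\<lambda>n. k \<bullet> y n)"
      unfolding inner_add_left by (intro limI tendsto_add conv)
    show "lim (\<lambda>n. (c *\<^sub>R h) \<bullet> y n) = c *\<^sub>R lim (\<lambda>n. h \<bullet> y n)"
      unfolding inner_scaleR_left real_scaleR_def by (intro limI tendsto_mult_left conv)
    show "norm (lim (\<lambda>n. h \<bullet> y n)) \<le> norm h * B"
      using inner_le[of h] by (intro LIMSEQ_le_const2[OF tendsto_norm[OF conv]]) auto
  qed
  then obtain l where l: "lim (\<lambda>n. h \<bullet> y n) = l \<bullet> h" for h
    using riesz_representation[of "Blinfun (\<lambda>h. lim (\<lambda>n. h \<bullet> y n))"]
    by (metis bounded_linear_Blinfun_apply)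
  have "(\<lambda>n. blinfun_apply g (y n)) \<longlonglongrightarrow> blinfun_apply g l" for g :: "'a \<Rightarrow>\<^sub>L real"
  proof -
    obtain r where r: "blinfun_apply g v = r \<bullet> v" for v
      using riesz_representation by blast
    show ?thesis
      using conv[of r] by (simp add: r l inner_commute[of l r])
  qed
  then show ?thesis
    unfolding converges_weakly_def by blast
qed

text \<open>By the bipolar property the order can be checked against dual-cone vectors, where it is
  the fact that a decreasing real sequence stays above its limit.\<close>

lemma weak_limit_le:
  fixes y :: "nat \<Rightarrow> 'a::{real_inner, complete_space, ordered_real_vector}"
  assumes cone: "closed {v::'a. 0 \<le> v}"
    and dec: "decseq y" and weak: "converges_weakly y l"
  shows "l \<le> y n"
proof -
  have "0 \<le> y n - l"
  proof (rule bipolar_cone[OF cone])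
    fix d :: 'a assume d: "\<And>v. 0 \<le> v \<Longrightarrow> 0 \<le> d \<bullet> v"
    have "(\<lambda>m. d \<bullet> y m) \<longlonglongrightarrow> d \<bullet> l"
      using weak unfolding converges_weakly_def by (metis blinfun_inner_right.rep_eq)
    moreover have "d \<bullet> y m \<le> d \<bullet> y n" if "m \<ge> n" for m
      using d[of "y n - y m"] decseqD[OF dec that] by (simp add: inner_simps)
    ultimately have "d \<bullet> l \<le> d \<bullet> y n"
      by (intro LIMSEQ_le_const2) auto
    then show "0 \<le> d \<bullet> (y n - l)"
      by (simp add: inner_simps)
  qed
  then show ?thesis by simp
qed

section \<open>Obstacle problems and the fixed-point iteration\<close>

locale T_monotone_operator = coercive_operator A C\<^sub>a C\<^sub>b
  for A :: "'a::{real_inner, complete_space, ordered_real_vector, lattice} \<Rightarrow> 'a \<Rightarrow>\<^sub>L real"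
    and C\<^sub>a C\<^sub>b :: real +
  assumes closed_cone: "closed {v::'a. 0 \<le> v}"
    and T_monotone: "\<And>u. blinfun_apply (A (pos_part u)) (neg_part u) \<le> 0"
begin

text \<open>For \<open>w = u - v\<close>, the form at the positive part equals \<open>A w\<close>
  plus \<open>A (neg_part w)\<close>, both tested with that part. Both terms are nonpositive, so
  coercivity makes the positive part vanish.\<close>

lemma le_if_pos_part_test:
  assumes "blinfun_apply (A (u - v)) (pos_part (u - v)) \<le> 0"
  shows "u \<le> v"
proof -
  let ?p = "pos_part (u - v)" and ?m = "neg_part (u - v)"
  \<comment> \<open>T-monotonicity has the two parts in the opposite order; it is applied to
    \<open>- w\<close>, whose parts are those of \<open>w\<close> exchanged.\<close>
  have swap: "neg_part w = pos_part (- w)" for w :: 'a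
    unfolding neg_part_def pos_part_def
  proof (rule antisym)
    have "sup 0 w \<le> sup 0 (- w) + w"
      using add_right_mono[OF sup_ge2[of "- w" 0], of w] add_right_mono[OF sup_ge1[of 0 "- w"], of w]
      by (intro sup_least) simp_all
    then show "sup 0 w - w \<le> sup 0 (- w)"
      by (simp add: diff_le_eq)
    show "sup 0 (- w) \<le> sup 0 w - w"
      using diff_right_mono[OF sup_ge1[of 0 w], of w] by (intro sup_least) simp_all
  qed
  have "blinfun_apply (A ?m) ?p \<le> 0"
    using T_monotone[of "- (u - v)"] swap[of "u - v"] swap[of "- (u - v)"] by simp
  moreover have "u - v = ?p - ?m"
    by (simp add: neg_part_def)
  then have "blinfun_apply (A ?p) ?p - blinfun_apply (A ?m) ?p \<le> 0"
    using assms by (metis A_simps(2) blinfun.diff_left)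
  ultimately have "?p = 0"
    by (intro eq_zero_if_nonpos) simp
  then have "u - v \<le> 0"
    unfolding pos_part_def by (metis sup_ge2)
  then show ?thesis by simp
qed

lemma pos_part_nonneg: "0 \<le> pos_part (u :: 'a)"
  by (simp add: pos_part_def)

text \<open>The test vectors \<open>z\<^sub>1 - ?p\<close> and \<open>z\<^sub>2 + ?p\<close> are the
  infimum and supremum of the two solutions, both admissible. Equal obstacles give
  uniqueness.\<close>

lemma solves_vi_mono:
  assumes "solves_vi A f w\<^sub>1 z\<^sub>1" "solves_vi A f w\<^sub>2 z\<^sub>2" "w\<^sub>1 \<le> w\<^sub>2"
  shows "z\<^sub>1 \<le> z\<^sub>2"
proof -
  let ?p = "pos_part (z\<^sub>1 - z\<^sub>2)"
  have "z\<^sub>1 - ?p \<le> w\<^sub>1"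
    using assms(1) order_trans[of "z\<^sub>1 - ?p" z\<^sub>1 w\<^sub>1] pos_part_nonneg[of "z\<^sub>1 - z\<^sub>2"]
    by (simp add: solves_vi_def)
  then have "blinfun_apply (A z\<^sub>1 - f) (z\<^sub>1 - (z\<^sub>1 - ?p)) \<le> 0"
    using assms(1) unfolding solves_vi_def by blast
  moreover have "?p \<le> w\<^sub>2 - z\<^sub>2"
    using assms order_trans[of z\<^sub>1 w\<^sub>1 w\<^sub>2]
    unfolding pos_part_def solves_vi_def by (intro sup_least) (auto simp: diff_right_mono)
  then have "z\<^sub>2 + ?p \<le> w\<^sub>2"
    by (simp add: le_diff_eq add.commute)
  then have "blinfun_apply (A z\<^sub>2 - f) (z\<^sub>2 - (z\<^sub>2 + ?p)) \<le> 0"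
    using assms(2) unfolding solves_vi_def by blast
  ultimately show ?thesis
    by (intro le_if_pos_part_test) (simp add: A_simps)
qed

text \<open>Comparison with the problem without obstacle: only the downward test
  \<open>z - ?p\<close> is needed, and it is admissible for every \<open>w\<close>.\<close>

lemma solves_vi_le_inv:
  assumes "solves_vi A f w z"
  shows "z \<le> inv A f"
proof (rule le_if_pos_part_test)
  let ?p = "pos_part (z - inv A f)"
  have "z - ?p \<le> w"
    using assms order_trans[of "z - ?p" z w] pos_part_nonneg[of "z - inv A f"]
    by (simp add: solves_vi_def)
  then have "blinfun_apply (A z - f) (z - (z - ?p)) \<le> 0"
    using assms unfolding solves_vi_def by blast
  moreover have "A (inv A f) = f"
    using bij_A by (simp add: bij_is_surj surj_f_inv_f)
  ultimately show "blinfun_apply (A (z - inv A f)) ?p \<le> 0"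
    by (simp add: A_simps)
qed

text \<open>Justifies the definite description: the feasible set is closed, convex and contains
  \<open>\<Phi> \<psi>\<close>, and comparison in both directions gives uniqueness.\<close>

lemma solves_vi_vi_sol: "solves_vi A f (\<Phi> \<psi>) (vi_sol A \<Phi> f \<psi>)"
  unfolding vi_sol_def
proof (rule theI')
  have "{v. v \<le> \<Phi> \<psi>} = (\<lambda>v. \<Phi> \<psi> - v) -` {v. 0 \<le> v}"
    by auto
  then have "closed {v. v \<le> \<Phi> \<psi>}"
    using closed_vimage[OF closed_cone, of "\<lambda>v. \<Phi> \<psi> - v"] by (simp add: continuous_intros)
  moreover have "convex {v. v \<le> \<Phi> \<psi>}"
  proof (rule convexI)
    fix x y :: 'a and s t :: real
    assume "x \<in> {v. v \<le> \<Phi> \<psi>}" "y \<in> {v. v \<le> \<Phi> \<psi>}" "0 \<le> s" "0 \<le> t" "s + t = 1"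
    then have "s *\<^sub>R x + t *\<^sub>R y \<le> s *\<^sub>R \<Phi> \<psi> + t *\<^sub>R \<Phi> \<psi>"
      by (intro add_mono scaleR_left_mono) auto
    also have "\<dots> = \<Phi> \<psi>"
      using \<open>s + t = 1\<close> by (metis scaleR_left_distrib scaleR_one)
    finally show "s *\<^sub>R x + t *\<^sub>R y \<in> {v. v \<le> \<Phi> \<psi>}" by simp
  qed
  ultimately obtain z where "solves_vi A f (\<Phi> \<psi>) z"
    using variational_inequality_ex[of "{v. v \<le> \<Phi> \<psi>}" f] unfolding solves_vi_def by auto
  then show "\<exists>!z. solves_vi A f (\<Phi> \<psi>) z"
    using solves_vi_mono by (blast intro: antisym)
qed

section \<open>Monotonicity and boundedness of the iterates\<close>

lemma decseq_qvi_iter: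
  assumes "mono \<Phi>"
  shows "decseq (qvi_iter A \<Phi> f)"
proof (rule decseq_SucI)
  fix n
  show "qvi_iter A \<Phi> f (Suc n) \<le> qvi_iter A \<Phi> f n"
  proof (induction n)
    \<comment> \<open>The iteration starts from the solution without obstacle, so its first step
      goes down; later steps inherit the order through the obstacles.\<close>
    case 0
    show ?case using solves_vi_le_inv[OF solves_vi_vi_sol] by simp
  next
    case (Suc n)
    from monoD[OF assms Suc] show ?case
      using solves_vi_mono solves_vi_vi_sol by (metis qvi_iter.simps(2))
  qed
qed

lemma norm_qvi_iter_Suc:
  assumes "v \<le> \<Phi> (qvi_iter A \<Phi> f n)"
  defines "z \<equiv> qvi_iter A \<Phi> f (Suc n)"
  shows "C\<^sub>a * (norm z)\<^sup>2 \<le> C\<^sub>b * norm z * norm v + norm f * (norm z + norm v)"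
  using solves_vi_vi_sol[of f \<Phi> "qvi_iter A \<Phi> f n"] assms
  unfolding solves_vi_def z_def by (intro estimate_if_nonpos) simp

text \<open>A ball of radius \<open>B\<close> is invariant: a test vector bounded by
  \<open>C\<^sub>X * B + b\<close> keeps the next iterate inside, because the slope condition leaves
  room for the lower-order terms.\<close>

lemma qvi_iter_bounded:
  assumes "(\<exists>v0. \<forall>v. v0 \<le> \<Phi> v) \<or>
    (\<exists>C\<^sub>X < C\<^sub>a / C\<^sub>b. \<forall>v. norm (\<Phi> v) \<le> C\<^sub>X * norm v)"
  shows "\<exists>B. \<forall>n. norm (qvi_iter A \<Phi> f n) \<le> B"
proof -
  text \<open>Both alternatives provide test functions of affine growth with a slope below
    \<open>C\<^sub>a / C\<^sub>b\<close>.\<close>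
  obtain C\<^sub>X b where C: "0 \<le> C\<^sub>X" "C\<^sub>X < C\<^sub>a / C\<^sub>b" "0 \<le> b"
    and test: "\<exists>w \<le> \<Phi> v. norm w \<le> C\<^sub>X * norm v + b" for v
  proof -
    from assms consider v0 where "\<forall>v. v0 \<le> \<Phi> v"
      | C where "C < C\<^sub>a / C\<^sub>b" "\<forall>v. norm (\<Phi> v) \<le> C * norm v" by blast
    then show thesis
    proof cases
      case 1
      then show thesis using C_pos by (intro that[of 0 "norm v0"]) auto
    next
      case 2
      \<comment> \<open>The sign of \<open>C\<close> is not given; \<open>max 0 C\<close> is a
        nonnegative slope still below \<open>C\<^sub>a / C\<^sub>b\<close>.\<close>
      have "norm (\<Phi> v) \<le> max 0 C * norm v" for v
        using 2(2) mult_right_mono[of C "max 0 C" "norm v"]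
        by (meson max.cobounded2 norm_ge_zero order_trans)
      then show thesis
        using 2(1) C_pos by (intro that[of "max 0 C" 0]) auto
    qed
  qed
  let ?y = "qvi_iter A \<Phi> f"
  define k where "k = C\<^sub>a - C\<^sub>b * C\<^sub>X"
  have k: "k > 0" using C C_pos by (simp add: k_def field_simps)
  \<comment> \<open>\<open>m\<close> collects the lower-order terms. In \<open>B\<close>, the entry
    \<open>m / k\<close> gives \<open>C\<^sub>b * C\<^sub>X * B + m \<le> C\<^sub>a * B\<close>, the
    norm starts the induction, and 1 lets constants be absorbed into multiples of
    \<open>?z\<close>.\<close>
  define m where "m = C\<^sub>b * b + norm f * (1 + C\<^sub>X + b)"
  define B where "B = max (max 1 (norm (inv A f))) (m / k)"
  have B: "B \<ge> 1" "m / k \<le> B"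
    by (simp_all add: B_def)
  then have mB: "m \<le> k * B"
    using k by (simp add: pos_divide_le_eq mult.commute)
  have "norm (?y n) \<le> B" for n
  proof (induction n)
    case 0
    then show ?case by (simp add: B_def)
  next
    case (Suc n)
    show ?case
    proof (rule ccontr)
      let ?z = "norm (?y (Suc n))"
      assume "\<not> ?z \<le> B"
      then have z: "?z > B" by simp
      obtain w where w: "w \<le> \<Phi> (?y n)" "norm w \<le> C\<^sub>X * norm (?y n) + b"
        using test by blast
      have wB: "norm w \<le> C\<^sub>X * B + b"
        using w(2) mult_left_mono[OF Suc C(1)] by linarith
      have "C\<^sub>X * B \<le> C\<^sub>X * ?z"
        using z C by (intro mult_left_mono) auto
      moreover have "b \<le> b * ?z"
        using z B C mult_left_mono[of 1 ?z b] by simp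
      \<comment> \<open>This cruder bound carries a factor \<open>?z\<close>, so that
        \<open>?z\<close> can be cancelled from the terms with \<open>norm f\<close> too.\<close>
      ultimately have wz: "norm w \<le> (C\<^sub>X + b) * ?z"
        using wB by (simp add: algebra_simps)
      have "?z * (C\<^sub>a * ?z) \<le> C\<^sub>b * ?z * norm w + norm f * (?z + norm w)"
        using norm_qvi_iter_Suc[of w \<Phi> f n] w(1) by (simp add: power2_eq_square mult_ac)
      also have "\<dots> \<le> C\<^sub>b * ?z * (C\<^sub>X * B + b) + norm f * (?z + (C\<^sub>X + b) * ?z)"
        using wB wz C_pos by (intro add_mono mult_left_mono) auto
      also have "\<dots> = ?z * (C\<^sub>b * C\<^sub>X * B + m)"
        by (simp add: m_def algebra_simps)
      also have "\<dots> \<le> ?z * (C\<^sub>a * B)"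
        using mB by (intro mult_left_mono) (auto simp: k_def algebra_simps)
      finally have "C\<^sub>a * ?z \<le> C\<^sub>a * B"
        by (rule mult_left_le_imp_le) (use z B in linarith)
      then show False
        using z C_pos by simp
    qed
  qed
  then show ?thesis by blast
qed

end

section \<open>Passage to the limit in the iteration\<close>

theorem theorem2p5:
  fixes A :: "'a::{real_inner, complete_space, ordered_real_vector, lattice} \<Rightarrow> 'a \<Rightarrow>\<^sub>L real"
    and \<Phi> :: "'a \<Rightarrow> 'a"
    and f :: "'a \<Rightarrow>\<^sub>L real"
    and C\<^sub>a C\<^sub>b :: real
  assumes closed_cone: "closed {v::'a. 0 \<le> v}"
    and A_linear: "linear A"
    and C_pos: "C\<^sub>a > 0" "C\<^sub>b > 0"
    and A_bounded: "\<And>u v. blinfun_apply (A u) v \<le> C\<^sub>b * norm u * norm v"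
    and A_coercive: "\<And>u. blinfun_apply (A u) u \<ge> C\<^sub>a * (norm u)\<^sup>2"
    and A_T_monotone: "\<And>u. blinfun_apply (A (pos_part u)) (neg_part u) \<le> 0"
    and Phi_increasing: "mono \<Phi>"
    and cond_a: "(\<exists>v0. \<forall>v. v0 \<le> \<Phi> v) \<or>
                 (\<exists>C\<^sub>X < C\<^sub>a / C\<^sub>b. \<forall>v. norm (\<Phi> v) \<le> C\<^sub>X * norm v)"
    and cond_b: "\<And>vs v. decseq vs \<Longrightarrow> converges_weakly vs v \<Longrightarrow>
                   (\<And>n. v \<le> \<Phi> (vs n)) \<Longrightarrow> v \<le> \<Phi> v"
  shows "\<exists>y. y \<le> inv A f \<and>
             y \<le> \<Phi> y \<and> (\<forall>v. v \<le> \<Phi> y \<longrightarrow> blinfun_apply (A y - f) (y - v) \<le> 0) \<and>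
             converges_weakly (qvi_iter A \<Phi> f) y"
proof -
  interpret T_monotone_operator A C\<^sub>a C\<^sub>b
    by (intro T_monotone_operator.intro coercive_operator.intro T_monotone_operator_axioms.intro
        closed_cone A_linear C_pos A_bounded A_coercive A_T_monotone)
  let ?y = "qvi_iter A \<Phi> f"
  have dec: "decseq ?y"
    using Phi_increasing by (rule decseq_qvi_iter)
  obtain B where "\<And>n. norm (?y n) \<le> B"
    using qvi_iter_bounded[OF cond_a] by blast
  from bounded_decseq_converges_weakly[OF closed_cone dec this]
  obtain y where weak: "converges_weakly ?y y" by blast
  have le: "y \<le> ?y n" for n
    using closed_cone dec weak by (rule weak_limit_le)
  have sol: "solves_vi A f (\<Phi> (?y n)) (?y (Suc n))" for n
    using solves_vi_vi_sol by simp
  have "y \<le> \<Phi> (?y n)" for n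
    using le[of "Suc n"] sol[of n] unfolding solves_vi_def by (meson order_trans)
  then have "y \<le> \<Phi> y"
    by (rule cond_b[OF dec weak])
  moreover have "blinfun_apply (A y - f) (y - v) \<le> 0" if "v \<le> \<Phi> y" for v
  proof (rule weak_limit_inequality[OF weak])
    fix n
    \<comment> \<open>Since \<open>y\<close> lies below every iterate,
      \<open>\<Phi> y \<le> \<Phi> (?y n)\<close>: a single \<open>v\<close> tests all the
      inequalities at once.\<close>
    have "v \<le> \<Phi> (?y n)"
      using that monoD[OF Phi_increasing le[of n]] by (rule order_trans)
    then show "blinfun_apply (A (?y (Suc n)) - f) (?y (Suc n) - v) \<le> 0"
      using sol[of n] unfolding solves_vi_def by blast
  qed
  moreover have "y \<le> inv A f"
    using le[of 0] by simp
  ultimately show ?thesis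
    using weak by blast
qed

end
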